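(* Let $0\le\varepsilon\le1$, let $t\ge2$ be an integer, and let $G$ be a red-blue $K_n$. If $G$ is $\varepsilon$-unbalanced, then $G$ has at most $\left(1-\frac{\varepsilon^4}{4}\right)2n\left(\frac{n-1}{2}\right)^{t}$ alternating walks of length $t$.
   Context: A red-blue $K_n$ is a complete graph on vertex set $V$, $|V|=n$, each of whose edges is coloured red or blue; $d_R(x)$ is the number of red edges at $x$. $G$ is $\varepsilon$-balanced if $\sum_{x\in V}\left|d_R(x)-\frac{n-1}{2}\right|\le\varepsilon\binom n2$, and $\varepsilon$-unbalanced otherwise. A walk of length $t$ is an ordered tuple $(v_0,\ldots,v_t)$ of vertices with $v_{i-1}v_i$ an edge for all $i\in[t]$; it is alternating if $v_{i-1}v_i$ and $v_iv_{i+1}$ have different colours for each $i\in[t-1]$. *)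

theory Defs
  imports Complex_Main "HOL-Library.Ramsey"
begin

datatype edge_colour = Red | Blue

text \<open>
  A red-blue complete graph is given by its finite vertex set \<open>V\<close> and a colouring \<open>c\<close> of
  two-element sets; only the values of \<open>c\<close> on \<open>[V]\<^bsup>2\<^esup>\<close>, the edges of the complete graph
  on \<open>V\<close>, are ever used.
\<close>

definition red_degree :: "'a set \<Rightarrow> ('a set \<Rightarrow> edge_colour) \<Rightarrow> 'a \<Rightarrow> nat" where
  "red_degree V c x = card {e \<in> [V]\<^bsup>2\<^esup>. x \<in> e \<and> c e = Red}"

definition balanced :: "real \<Rightarrow> 'a set \<Rightarrow> ('a set \<Rightarrow> edge_colour) \<Rightarrow> bool" where
  "balanced \<epsilon> V c \<longleftrightarrow>
     (\<Sum>x\<in>V. \<bar>real (red_degree V c x) - (real (card V) - 1) / 2\<bar>) \<le> \<epsilon> * real (card V choose 2)"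

definition unbalanced :: "real \<Rightarrow> 'a set \<Rightarrow> ('a set \<Rightarrow> edge_colour) \<Rightarrow> bool" where
  "unbalanced \<epsilon> V c \<longleftrightarrow> \<not> balanced \<epsilon> V c"

text \<open>The tuple \<open>(v\<^sub>0, \<dots>, v\<^sub>t)\<close> is the list \<open>w\<close> of length \<open>t + 1\<close> with \<open>w ! i = v\<^sub>i\<close>.\<close>

definition is_walk :: "'a set \<Rightarrow> nat \<Rightarrow> 'a list \<Rightarrow> bool" where
  "is_walk V t w \<longleftrightarrow>
     length w = t + 1 \<and> set w \<subseteq> V \<and> (\<forall>i\<in>{1..t}. {w ! (i - 1), w ! i} \<in> [V]\<^bsup>2\<^esup>)"

definition is_alternating :: "('a set \<Rightarrow> edge_colour) \<Rightarrow> nat \<Rightarrow> 'a list \<Rightarrow> bool" where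
  "is_alternating c t w \<longleftrightarrow>
     (\<forall>i\<in>{1..t - 1}. c {w ! (i - 1), w ! i} \<noteq> c {w ! i, w ! (i + 1)})"

definition alternating_walks :: "'a set \<Rightarrow> ('a set \<Rightarrow> edge_colour) \<Rightarrow> nat \<Rightarrow> 'a list set" where
  "alternating_walks V c t = {w. is_walk V t w \<and> is_alternating c t w}"

end

theory Submission imports Defs "HOL-Analysis.Convex" begin

text \<open>
  Let the transfer operator \<open>T\<close> send a function \<open>f\<close> on directed edges to
  \<open>(u, v) \<mapsto> \<Sum> f (v, w)\<close>, summed over all \<open>w\<close> for which \<open>vw\<close> and \<open>uv\<close> have different colours,
  so that there are \<open>\<langle>1, T\<^bsup>t - 1\<^esup> 1\<rangle>\<close> alternating walks of length \<open>t\<close>.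
  At each vertex \<open>v\<close> it consists of two all-ones blocks of sizes \<open>r \<times> b\<close> and \<open>b \<times> r\<close>, where
  \<open>r\<close> and \<open>b\<close> are the red and blue degrees of \<open>v\<close>; hence its norm is at most
  \<open>max \<surd>(r b) \<le> (n - 1) / 2\<close>.
  Moreover \<open>\<parallel>T 1\<parallel>\<^sup>2 = (n - 1) \<Sum> r b\<close>, and by Cauchy--Schwarz an unbalanced colouring has
  \<open>\<Sum> r b \<le> (1 - \<epsilon>\<^sup>2) n (n - 1)\<^sup>2 / 4\<close>. This yields the factor
  \<open>\<surd>(1 - \<epsilon>\<^sup>2) \<le> 1 - \<epsilon>\<^sup>2 / 2 \<le> 1 - \<epsilon>\<^sup>4 / 4\<close>.
\<close>

section \<open>Colour neighbourhoods and degrees\<close>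

fun other_colour :: "edge_colour \<Rightarrow> edge_colour" where
  "other_colour Red = Blue"
| "other_colour Blue = Red"

lemma other_colour_iff: "k \<noteq> l \<longleftrightarrow> l = other_colour k"
  by (cases k; cases l) auto

definition nbhd :: "'a set \<Rightarrow> ('a set \<Rightarrow> edge_colour) \<Rightarrow> edge_colour \<Rightarrow> 'a \<Rightarrow> 'a set" where
  "nbhd V c k v = {u \<in> V. u \<noteq> v \<and> c {v, u} = k}"

text \<open>The guard \<open>0 < t\<close> makes the colour condition void at length 0, so both
  colours give the single walk \<open>[v]\<close>: the constant function 1 from which the recursion
  starts.\<close>

definition walks_from ::
    "'a set \<Rightarrow> ('a set \<Rightarrow> edge_colour) \<Rightarrow> edge_colour \<Rightarrow> nat \<Rightarrow> 'a \<Rightarrow> 'a list set" where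
  "walks_from V c k t v =
     {w \<in> alternating_walks V c t. w ! 0 = v \<and> (0 < t \<longrightarrow> c {w ! 0, w ! 1} = k)}"

lemma finite_nbhd [simp]: "finite V \<Longrightarrow> finite (nbhd V c k v)"
  by (simp add: nbhd_def)

lemma card_nbhd_add:
  assumes "finite V" "v \<in> V"
  shows "card (nbhd V c Red v) + card (nbhd V c Blue v) = card V - 1"
proof -
  have "V - {v} = nbhd V c Red v \<union> nbhd V c Blue v"
    using assms(2) by (auto simp: nbhd_def intro: edge_colour.exhaust)
  moreover have "nbhd V c Red v \<inter> nbhd V c Blue v = {}"
    by (auto simp: nbhd_def)
  ultimately show ?thesis
    using assms card_Un_disjoint[of "nbhd V c Red v" "nbhd V c Blue v"]
    by (metis card_Diff_singleton finite_nbhd)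
qed

lemma red_degree_eq_card_nbhd:
  assumes "v \<in> V"
  shows "red_degree V c v = card (nbhd V c Red v)"
proof -
  have "{e \<in> [V]\<^bsup>2\<^esup>. v \<in> e \<and> c e = Red} = (\<lambda>u. {v, u}) ` nbhd V c Red v"
  proof (intro equalityI subsetI)
    fix e assume e: "e \<in> {e \<in> [V]\<^bsup>2\<^esup>. v \<in> e \<and> c e = Red}"
    then obtain u where "e = {v, u}" "u \<noteq> v"
      by (auto simp: nsets_def card_2_iff)
    then show "e \<in> (\<lambda>u. {v, u}) ` nbhd V c Red v"
      using e by (auto simp: nbhd_def nsets_def)
  qed (use assms in \<open>auto simp: nbhd_def nsets_def\<close>)
  moreover have "inj_on (\<lambda>u. {v, u}) (nbhd V c Red v)"
    by (auto simp: inj_on_def nbhd_def doubleton_eq_iff)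
  ultimately show ?thesis
    by (simp add: red_degree_def card_image)
qed

section \<open>Recursive structure of alternating walks\<close>

lemma pair_in_nsets_2_iff: "{u, v} \<in> [V]\<^bsup>2\<^esup> \<longleftrightarrow> u \<in> V \<and> v \<in> V \<and> u \<noteq> v"
  by (auto simp: nsets_def card_insert_if)

lemma finite_alternating_walks:
  assumes "finite V"
  shows "finite (alternating_walks V c t)"
  by (rule finite_subset[OF _ finite_lists_length_eq[OF assms, of "t + 1"]])
     (auto simp: alternating_walks_def is_walk_def)

lemma finite_walks_from [simp]: "finite V \<Longrightarrow> finite (walks_from V c k t v)"
  using finite_alternating_walks[of V c t] by (simp add: walks_from_def)

text \<open>Peels off the first edge of a walk. The general binary \<open>P\<close> serves both the
  adjacency and the colour condition.\<close>

lemma Ball_atLeast1_Suc_iff: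
  "(\<forall>i\<in>{1..Suc t}. P (i - 1) i) \<longleftrightarrow> P 0 1 \<and> (\<forall>i\<in>{1..t}. P i (Suc i))"
proof -
  have "{1..Suc t} = insert 1 (Suc ` {1..t})"
    by auto
  then have "(\<forall>i\<in>{1..Suc t}. P (i - 1) i) \<longleftrightarrow> (\<forall>i\<in>insert 1 (Suc ` {1..t}). P (i - 1) i)"
    by (simp only:)
  then show ?thesis
    by (simp del: image_Suc_atLeastAtMost)
qed

lemma is_walk_Cons_iff:
  "is_walk V (Suc t) (v # w) \<longleftrightarrow> is_walk V t w \<and> v \<in> V \<and> w ! 0 \<in> V \<and> v \<noteq> w ! 0"
  unfolding is_walk_def Ball_atLeast1_Suc_iff[where P="\<lambda>i j. {(v # w) ! i, (v # w) ! j} \<in> [V]\<^bsup>2\<^esup>"]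
  by (auto simp: pair_in_nsets_2_iff nth_Cons')

lemma is_alternating_Cons_iff:
  "is_alternating c (Suc t) (v # w) \<longleftrightarrow>
     is_alternating c t w \<and> (0 < t \<longrightarrow> c {v, w ! 0} \<noteq> c {w ! 0, w ! 1})"
proof (cases t)
  case (Suc s)
  show ?thesis
    using Ball_atLeast1_Suc_iff[of s "\<lambda>i j. c {(v # w) ! i, (v # w) ! j} \<noteq> c {(v # w) ! j, (v # w) ! (j + 1)}"]
    by (auto simp: is_alternating_def Suc nth_Cons')
qed (simp add: is_alternating_def)

lemma walks_from_0: "v \<in> V \<Longrightarrow> walks_from V c k 0 v = {[v]}"
  by (auto simp: walks_from_def alternating_walks_def is_walk_def is_alternating_def length_Suc_conv)

text \<open>Deleting the first vertex leaves a walk that starts at a \<open>k\<close>-neighbour of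
  \<open>v\<close> and, if it has an edge, continues in the other colour.\<close>

lemma walks_from_Suc:
  assumes "v \<in> V"
  shows "walks_from V c k (Suc t) v =
           (\<Union>u\<in>nbhd V c k v. (#) v ` walks_from V c (other_colour k) t u)"
proof (intro set_eqI)
  fix w
  show "w \<in> walks_from V c k (Suc t) v \<longleftrightarrow>
          w \<in> (\<Union>u\<in>nbhd V c k v. (#) v ` walks_from V c (other_colour k) t u)"
  proof (cases w)
    case Nil
    then show ?thesis
      by (auto simp: walks_from_def alternating_walks_def is_walk_def)
  next
    case (Cons x w')
    then show ?thesis
      using assms
      by (auto simp: walks_from_def alternating_walks_def is_walk_Cons_iff
          is_alternating_Cons_iff nbhd_def other_colour_iff)
  qed
qed

lemma card_walks_from_Suc:
  assumes "finite V" "v \<in> V"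
  shows "card (walks_from V c k (Suc t) v) =
           (\<Sum>u\<in>nbhd V c k v. card (walks_from V c (other_colour k) t u))"
  unfolding walks_from_Suc[OF assms(2)]
  by (subst card_UN_disjoint) (auto simp: assms card_image, auto simp: walks_from_def)

text \<open>Positive length is essential: at length 0 the two colour classes coincide instead of
  being disjoint.\<close>

lemma card_alternating_walks_Suc:
  assumes "finite V"
  shows "card (alternating_walks V c (Suc t)) =
           (\<Sum>v\<in>V. card (walks_from V c Red (Suc t) v) + card (walks_from V c Blue (Suc t) v))"
proof -
  have "w ! 0 \<in> V \<and> (c {w ! 0, w ! 1} = Red \<or> c {w ! 0, w ! 1} = Blue)"
    if "w \<in> alternating_walks V c (Suc t)" for w
    using that by (cases "c {w ! 0, w ! 1}") (auto simp: alternating_walks_def is_walk_def)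
  then have "alternating_walks V c (Suc t) =
      (\<Union>v\<in>V. walks_from V c Red (Suc t) v \<union> walks_from V c Blue (Suc t) v)"
    unfolding walks_from_def by blast
  also have "card \<dots> = (\<Sum>v\<in>V. card (walks_from V c Red (Suc t) v \<union> walks_from V c Blue (Suc t) v))"
    using assms by (subst card_UN_disjoint) (auto simp: walks_from_def[of _ _ _ "Suc t"] finite_alternating_walks)
  also have "\<dots> = (\<Sum>v\<in>V. card (walks_from V c Red (Suc t) v) + card (walks_from V c Blue (Suc t) v))"
    using assms by (intro sum.cong card_Un_disjoint) (auto simp: walks_from_def[of _ _ _ "Suc t"] finite_alternating_walks)
  finally show ?thesis .
qed

section \<open>Energy estimates for the transfer operator\<close>

text \<open>Double counting: adjacency in colour \<open>k\<close> is symmetric, so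
  \<open>f u\<close> occurs once for each \<open>k\<close>-neighbour of \<open>u\<close>.\<close>

lemma sum_sum_nbhd:
  fixes f :: "'a \<Rightarrow> real"
  assumes "finite V"
  shows "(\<Sum>v\<in>V. \<Sum>u\<in>nbhd V c k v. f u) = (\<Sum>u\<in>V. real (card (nbhd V c k u)) * f u)"
proof -
  have "(\<Sum>v\<in>V. \<Sum>u\<in>nbhd V c k v. f u) = (\<Sum>v\<in>V. \<Sum>u | u \<in> V \<and> v \<in> nbhd V c k u. f u)"
    by (intro sum.cong refl) (auto simp: nbhd_def insert_commute)
  also have "\<dots> = (\<Sum>u\<in>V. \<Sum>v | v \<in> V \<and> v \<in> nbhd V c k u. f u)"
    using assms by (intro sum.swap_restrict)
  also have "\<dots> = (\<Sum>u\<in>V. \<Sum>v\<in>nbhd V c k u. f u)"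
    by (intro sum.cong refl) (auto simp: nbhd_def)
  finally show ?thesis by simp
qed

text \<open>
  The squared norm of \<open>T\<^bsup>t\<^esup> 1\<close>: its value at a red edge \<open>(u, v)\<close> is the number of
  alternating walks of length \<open>t\<close> from \<open>v\<close> that start with a blue edge.
\<close>

definition walk_energy :: "'a set \<Rightarrow> ('a set \<Rightarrow> edge_colour) \<Rightarrow> nat \<Rightarrow> real" where
  "walk_energy V c t =
     (\<Sum>v\<in>V. real (card (nbhd V c Red v)) * (real (card (walks_from V c Blue t v)))\<^sup>2
           + real (card (nbhd V c Blue v)) * (real (card (walks_from V c Red t v)))\<^sup>2)"

text \<open>With colour degrees r and b, the term at a vertex is r b^2 + b r^2 = (r + b) r
  b.\<close>

lemma walk_energy_1:
  assumes "finite V"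
  shows "walk_energy V c 1 =
    (real (card V) - 1) * (\<Sum>v\<in>V. real (card (nbhd V c Red v)) * real (card (nbhd V c Blue v)))"
proof -
  have "card (walks_from V c k 1 v) = card (nbhd V c k v)" if "v \<in> V" for k v
  proof -
    have "card (walks_from V c k 1 v) = (\<Sum>u\<in>nbhd V c k v. 1)"
      unfolding One_nat_def card_walks_from_Suc[OF assms that]
      by (intro sum.cong refl) (auto simp: walks_from_0 nbhd_def)
    then show ?thesis by simp
  qed
  moreover have "real (card V) - 1 = real (card (nbhd V c Red v)) + real (card (nbhd V c Blue v))"
    if "v \<in> V" for v
  proof -
    have "card V > 0" using assms that card_gt_0_iff by blast
    then show ?thesis using card_nbhd_add[OF assms that, of c] by linarith
  qed
  ultimately show ?thesis
    unfolding walk_energy_def sum_distrib_left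
    by (intro sum.cong refl) (simp add: power2_eq_square algebra_simps)
qed

text \<open>Cauchy-Schwarz over the \<open>k\<close>-neighbours costs their number, while the energy
  carries the degree in the other colour as weight; the product of the two degrees is at most
  \<open>(?m / 2)\<^sup>2\<close>.\<close>

lemma walk_energy_Suc:
  assumes "finite V"
  shows "walk_energy V c (Suc t) \<le> ((real (card V) - 1) / 2)\<^sup>2 * walk_energy V c t"
proof -
  let ?m = "real (card V) - 1"
  let ?d = "\<lambda>k v. real (card (nbhd V c k v))"
  let ?x = "\<lambda>k t v. real (card (walks_from V c k t v))"
  let ?S = "\<lambda>k v. \<Sum>u\<in>nbhd V c k v. (?x (other_colour k) t u)\<^sup>2"
  have cs: "(?x k (Suc t) v)\<^sup>2 \<le> ?d k v * ?S k v" if "v \<in> V" for k v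
  proof -
    have "?x k (Suc t) v = (\<Sum>u\<in>nbhd V c k v. 1 * ?x (other_colour k) t u)"
      by (simp add: card_walks_from_Suc[OF assms that])
    then show ?thesis
      using Cauchy_Schwarz_ineq_sum[of "\<lambda>_. 1" "?x (other_colour k) t" "nbhd V c k v"] by simp
  qed
  have "?d Red v * (?x Blue (Suc t) v)\<^sup>2 + ?d Blue v * (?x Red (Suc t) v)\<^sup>2
          \<le> (?m / 2)\<^sup>2 * (?S Blue v + ?S Red v)" if v: "v \<in> V" for v
  proof -
    have "card V > 0" using assms v card_gt_0_iff by blast
    then have m: "?m = ?d Red v + ?d Blue v"
      using card_nbhd_add[OF assms v, of c] by linarith
    have "(?m / 2)\<^sup>2 - ?d Red v * ?d Blue v = ((?d Red v - ?d Blue v) / 2)\<^sup>2"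
      unfolding m by (simp add: power2_eq_square field_simps)
    then have rb: "?d Red v * ?d Blue v \<le> (?m / 2)\<^sup>2"
      using zero_le_power2[of "(?d Red v - ?d Blue v) / 2"] by linarith
    have "?d Red v * (?x Blue (Suc t) v)\<^sup>2 + ?d Blue v * (?x Red (Suc t) v)\<^sup>2
        \<le> ?d Red v * (?d Blue v * ?S Blue v) + ?d Blue v * (?d Red v * ?S Red v)"
      by (intro add_mono mult_left_mono cs v) auto
    also have "\<dots> = (?d Red v * ?d Blue v) * (?S Blue v + ?S Red v)"
      by (simp add: algebra_simps)
    also have "\<dots> \<le> (?m / 2)\<^sup>2 * (?S Blue v + ?S Red v)"
      by (intro mult_right_mono rb add_nonneg_nonneg sum_nonneg) auto
    finally show ?thesis .
  qed
  then have "walk_energy V c (Suc t) \<le> (\<Sum>v\<in>V. (?m / 2)\<^sup>2 * (?S Blue v + ?S Red v))"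
    unfolding walk_energy_def by (rule sum_mono)
  also have "\<dots> = (?m / 2)\<^sup>2 * ((\<Sum>v\<in>V. ?S Blue v) + (\<Sum>v\<in>V. ?S Red v))"
    by (simp only: sum_distrib_left[symmetric] sum.distrib)
  \<comment> \<open>Double counting turns the sums over neighbours back into degree weights, again
    paired with the opposite colour.\<close>
  also have "\<dots> = (?m / 2)\<^sup>2 * walk_energy V c t"
    unfolding sum_sum_nbhd[OF assms] walk_energy_def by (simp add: sum.distrib add.commute)
  finally show ?thesis .
qed

text \<open>The iteration stops at length 1, where the imbalance enters.\<close>

lemma walk_energy_le:
  assumes "finite V"
  shows "walk_energy V c (Suc t) \<le> ((real (card V) - 1) / 2) ^ (2 * t) * walk_energy V c 1"
proof (induction t)
  case (Suc t)
  have "walk_energy V c (Suc (Suc t)) \<le> ((real (card V) - 1) / 2)\<^sup>2 * walk_energy V c (Suc t)"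
    by (rule walk_energy_Suc[OF assms])
  also have "\<dots> \<le> ((real (card V) - 1) / 2)\<^sup>2 * (((real (card V) - 1) / 2) ^ (2 * t) * walk_energy V c 1)"
    by (intro mult_left_mono Suc.IH) simp
  finally show ?case
    by (simp add: power2_eq_square mult.assoc)
qed simp

text \<open>Cauchy-Schwarz for the inner product of 1 and \<open>T^t 1\<close>; the squared norm of
  1 is the number n(n - 1) of directed edges.\<close>

lemma card_alternating_walks_squared_le:
  assumes "finite V"
  shows "(real (card (alternating_walks V c (Suc t))))\<^sup>2
           \<le> real (card V) * (real (card V) - 1) * walk_energy V c t"
proof -
  let ?d = "\<lambda>k v. real (card (nbhd V c k v))"
  let ?x = "\<lambda>k t v. real (card (walks_from V c k t v))"
  let ?I = "V \<times> {Red, Blue}"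
  have total: "(\<Sum>v\<in>V. ?d Red v + ?d Blue v) = real (card V) * (real (card V) - 1)"
  proof -
    have "?d Red v + ?d Blue v = real (card V) - 1" if "v \<in> V" for v
    proof -
      have "card V > 0" using assms that card_gt_0_iff by blast
      then show ?thesis using card_nbhd_add[OF assms that, of c] by linarith
    qed
    then show ?thesis by simp
  qed
  have colours: "(\<Sum>p\<in>?I. f p) = (\<Sum>v\<in>V. f (v, Red) + f (v, Blue))" for f :: "'a \<times> edge_colour \<Rightarrow> real"
    using sum.cartesian_product[of "\<lambda>v k. f (v, k)" "{Red, Blue}" V] by simp
  have "real (card (alternating_walks V c (Suc t)))
      = (\<Sum>v\<in>V. \<Sum>u\<in>nbhd V c Red v. ?x Blue t u) + (\<Sum>v\<in>V. \<Sum>u\<in>nbhd V c Blue v. ?x Red t u)"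
    by (simp add: card_alternating_walks_Suc[OF assms] card_walks_from_Suc[OF assms] sum.distrib)
  also have "\<dots> = (\<Sum>(v, k)\<in>?I. ?d k v * ?x (other_colour k) t v)"
    unfolding sum_sum_nbhd[OF assms] by (simp add: colours sum.distrib)
  \<comment> \<open>Splitting each degree into two square roots reduces the weighted inequality to
    the unweighted one.\<close>
  also have "\<dots> = (\<Sum>p\<in>?I. sqrt (?d (snd p) (fst p)) *
                       (sqrt (?d (snd p) (fst p)) * ?x (other_colour (snd p)) t (fst p)))"
    by (intro sum.cong refl) (auto simp: mult.assoc[symmetric])
  finally have "(real (card (alternating_walks V c (Suc t))))\<^sup>2
      \<le> (\<Sum>p\<in>?I. (sqrt (?d (snd p) (fst p)))\<^sup>2) *
        (\<Sum>p\<in>?I. (sqrt (?d (snd p) (fst p)) * ?x (other_colour (snd p)) t (fst p))\<^sup>2)"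
    by (simp only: Cauchy_Schwarz_ineq_sum)
  also have "\<dots> = real (card V) * (real (card V) - 1) * walk_energy V c t"
    unfolding walk_energy_def total[symmetric] by (simp add: colours power_mult_distrib)
  finally show ?thesis .
qed

section \<open>Effect of imbalance and the final bound\<close>

text \<open>Each degree product falls short of \<open>((real (card V) - 1) / 2)\<^sup>2\<close> by
  the squared deviation, and Cauchy-Schwarz bounds the sum of these squares below.\<close>

lemma unbalanced_sum_degree_product_le:
  assumes "finite V" "0 \<le> \<epsilon>" "unbalanced \<epsilon> V c"
  shows "(\<Sum>v\<in>V. real (card (nbhd V c Red v)) * real (card (nbhd V c Blue v)))
           \<le> (1 - \<epsilon>\<^sup>2) * real (card V) * ((real (card V) - 1) / 2)\<^sup>2"
proof -
  let ?n = "real (card V)"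
  let ?m = "real (card V) - 1"
  let ?r = "\<lambda>v. real (card (nbhd V c Red v))"
  define d where "d v = \<bar>?r v - ?m / 2\<bar>" for v
  \<comment> \<open>The empty graph is balanced, both sides being 0.\<close>
  have "V \<noteq> {}"
    using assms by (auto simp: unbalanced_def balanced_def)
  then have n: "?n \<ge> 1"
    using assms(1) by (simp add: Suc_leI card_gt_0_iff)
  have "(\<Sum>v\<in>V. \<bar>real (red_degree V c v) - ?m / 2\<bar>) = (\<Sum>v\<in>V. d v)"
    by (intro sum.cong refl) (simp add: d_def red_degree_eq_card_nbhd)
  moreover have "real (card V choose 2) = ?n * ?m / 2"
    using n by (simp add: choose_two real_of_nat_div of_nat_diff)
  ultimately have "\<epsilon> * (?n * ?m / 2) \<le> (\<Sum>v\<in>V. d v)"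
    using assms(3) by (simp only: unbalanced_def balanced_def not_le less_imp_le)
  then have "(\<epsilon> * (?n * ?m / 2))\<^sup>2 \<le> (\<Sum>v\<in>V. d v)\<^sup>2"
    using n assms(2) by (intro power_mono) auto
  also have "\<dots> \<le> ?n * (\<Sum>v\<in>V. (d v)\<^sup>2)"
    using Cauchy_Schwarz_ineq_sum[of "\<lambda>_. 1" d V] by simp
  finally have "?n * (\<epsilon>\<^sup>2 * ?n * (?m / 2)\<^sup>2) \<le> ?n * (\<Sum>v\<in>V. (d v)\<^sup>2)"
    by (simp add: power2_eq_square field_simps)
  then have low: "\<epsilon>\<^sup>2 * ?n * (?m / 2)\<^sup>2 \<le> (\<Sum>v\<in>V. (d v)\<^sup>2)"
    using n by (simp add: mult_le_cancel_left)
  have "?r v * real (card (nbhd V c Blue v)) = (?m / 2)\<^sup>2 - (d v)\<^sup>2" if "v \<in> V" for v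
  proof -
    have b: "real (card (nbhd V c Blue v)) = ?m - ?r v"
      using card_nbhd_add[OF assms(1) that, of c] n by linarith
    show ?thesis
      unfolding b by (simp add: d_def power2_eq_square algebra_simps)
  qed
  then have "(\<Sum>v\<in>V. ?r v * real (card (nbhd V c Blue v))) = ?n * (?m / 2)\<^sup>2 - (\<Sum>v\<in>V. (d v)\<^sup>2)"
    by (simp add: sum_subtractf)
  then show ?thesis
    using low by (simp add: left_diff_distrib)
qed

theorem theorem5p3:
  fixes \<epsilon> :: real and t n :: nat and V :: "'a set" and c :: "'a set \<Rightarrow> edge_colour"
  assumes "0 \<le> \<epsilon>" and "\<epsilon> \<le> 1"
    and "t \<ge> 2"
    and "finite V" and "card V = n"
    and "unbalanced \<epsilon> V c"
  shows "real (card (alternating_walks V c t))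
           \<le> (1 - \<epsilon> ^ 4 / 4) * (2 * real n * ((real n - 1) / 2) ^ t)"
proof -
  \<comment> \<open>The outer Cauchy-Schwarz and the energy at length 1 account for two edges,
    leaving \<open>s\<close> uses of the norm bound.\<close>
  obtain s where t: "t = Suc (Suc s)"
    using assms(3) by (metis add_2_eq_Suc le_Suc_ex)
  define h where "h = (real n - 1) / 2"
  have m: "real n - 1 = 2 * h"
    by (simp add: h_def)
  have "V \<noteq> {}"
    using assms by (auto simp: unbalanced_def balanced_def)
  then have "n \<ge> 1"
    using assms(4,5) by (metis Suc_leI card_gt_0_iff One_nat_def)
  then have h: "h \<ge> 0"
    by (simp add: h_def)
  have eps: "\<epsilon>\<^sup>2 \<le> 1" "\<epsilon> ^ 4 \<le> \<epsilon>\<^sup>2"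
    using assms(1,2) by (auto intro: power_le_one power_decreasing)
  have "(real (card (alternating_walks V c t)))\<^sup>2 \<le> real n * (2 * h) * walk_energy V c (Suc s)"
    using card_alternating_walks_squared_le[OF assms(4), of c "Suc s"] by (simp only: t m assms(5))
  also have "\<dots> \<le> real n * (2 * h) * (h ^ (2 * s) * (2 * h * ((1 - \<epsilon>\<^sup>2) * real n * h\<^sup>2)))"
  proof (intro mult_left_mono)
    have "walk_energy V c (Suc s) \<le> h ^ (2 * s) * walk_energy V c 1"
      using walk_energy_le[OF assms(4), of c s] by (simp add: assms(5) h_def)
    also have "walk_energy V c 1 \<le> 2 * h * ((1 - \<epsilon>\<^sup>2) * real n * h\<^sup>2)"
      unfolding walk_energy_1[OF assms(4)] assms(5) m
      using unbalanced_sum_degree_product_le[OF assms(4,1,6)] h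
      by (intro mult_left_mono) (auto simp: h_def assms(5))
    finally show "walk_energy V c (Suc s) \<le> h ^ (2 * s) * (2 * h * ((1 - \<epsilon>\<^sup>2) * real n * h\<^sup>2))"
      using h by (simp add: mult_left_mono)
  qed (use h in auto)
  also have "\<dots> = (1 - \<epsilon>\<^sup>2) * (2 * real n * h ^ t)\<^sup>2"
    by (simp add: t power2_eq_square power_mult algebra_simps)
  \<comment> \<open>Since 1 - x \<le> (1 - x/2)^2, the bound becomes a perfect square and roots can
    be taken.\<close>
  also have "\<dots> \<le> (1 - \<epsilon>\<^sup>2 / 2)\<^sup>2 * (2 * real n * h ^ t)\<^sup>2"
    by (intro mult_right_mono) (use assms(1) in \<open>auto simp: power2_eq_square algebra_simps\<close>)
  finally have "(real (card (alternating_walks V c t)))\<^sup>2 \<le> ((1 - \<epsilon>\<^sup>2 / 2) * (2 * real n * h ^ t))\<^sup>2"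
    by (simp only: power_mult_distrib)
  then have "real (card (alternating_walks V c t)) \<le> (1 - \<epsilon>\<^sup>2 / 2) * (2 * real n * h ^ t)"
    by (rule power2_le_imp_le) (use eps h in auto)
  also have "\<dots> \<le> (1 - \<epsilon> ^ 4 / 4) * (2 * real n * h ^ t)"
  proof (intro mult_right_mono)
    show "1 - \<epsilon>\<^sup>2 / 2 \<le> 1 - \<epsilon> ^ 4 / 4"
      using eps zero_le_power2[of \<epsilon>] by linarith
  qed (use h in auto)
  finally show ?thesis
    by (simp add: h_def)
qed

end
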